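(* Let $T\in\mathbb{N}$. The connecting operator $C^T$ admits the following representation in terms of the response vector: its matrix $(C^T_{ij})_{i,j=1}^T$ is given by $$C^T_{ij}=\sum_{k=0}^{T-\max\{i,j\}}r_{|i-j|+2k},\qquad i,j=1,\ldots,T,\qquad r_0=1 ,$$ that is, $(C^Tf,g)_{\mathcal{F}^T}=\sum_{i,j=1}^{T}C^T_{ij}f_{j-1}g_{i-1}$ for all $f,g\in\mathcal{F}^T$.
   Context: $\mathbb{N}=\{1,2,\ldots\}$, $\mathbb{N}_0=\mathbb{N}\cup\{0\}$. Fix a real sequence (potential) $(b_1,b_2,\ldots)$. For a real control $f=(f_0,f_1,\ldots)$, $u^f_{n,t}$ denotes the solution of $$u_{n,t+1}+u_{n,t-1}-u_{n+1,t}-u_{n-1,t}+b_nu_{n,t}=0\quad (n\in\mathbb{N},\ t\in\mathbb{N}_0),$$ $$u_{n,-1}=u_{n,0}=0\ (n\in\mathbb{N}),\qquad u_{0,t}=f_t\ (t\in\mathbb{N}_0).$$ $\mathcal{F}^T=\mathbb{R}^T$ is the space of controls $f=(f_0,\ldots,f_{T-1})$ and $\mathcal{H}^T=\mathbb{R}^T$ is the space of vectors $h=(h_1,\ldots,h_T)$, both with the standard inner product. The control operator $W^T:\mathcal{F}^T\to\mathcal{H}^T$ is $(W^Tf)_n=u^f_{n,T}$, $n=1,\ldots,T$ (these values depend only on $f_0,\ldots,f_{T-1}$). The connecting operator $C^T:\mathcal{F}^T\to\mathcal{F}^T$ is defined by $(C^Tf,g)_{\mathcal{F}^T}=(W^Tf,W^Tg)_{\mathcal{H}^T}=\sum_{n=1}^Tu^f_{n,T}u^g_{n,T}$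 for all $f,g\in\mathcal{F}^T$. The response vector $(r_0,r_1,r_2,\ldots)$, with $r_0=1$, is the convolution kernel of the response operator $f\mapsto(u^f_{1,t})_{t\ge1}$: $u^f_{1,t}=\sum_{s=0}^{t-1}r_sf_{t-1-s}$ for all controls $f$ and all $t\ge1$; equivalently $r_s=u^\delta_{1,s+1}$ for $\delta=(1,0,0,\ldots)$. *)

theory Defs
  imports Complex_Main "Jordan_Normal_Form.Matrix"
begin

text \<open>
  The potential is indexed by the positive integers: the value \<open>b 0\<close> is never used.
  In a solution \<open>u :: nat \<Rightarrow> int \<Rightarrow> real\<close> only the values at times \<open>t \<ge> -1\<close> matter,
  and the corner value \<open>u 0 (-1)\<close> is not constrained.
\<close>

definition is_solution ::
  "(nat \<Rightarrow> real) \<Rightarrow> (nat \<Rightarrow> real) \<Rightarrow> (nat \<Rightarrow> int \<Rightarrow> real) \<Rightarrow> bool" where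
  "is_solution b f u \<longleftrightarrow>
     (\<forall>n\<ge>1. \<forall>t\<ge>0. u n (t + 1) + u n (t - 1) - u (n + 1) t - u (n - 1) t + b n * u n t = 0) \<and>
     (\<forall>n\<ge>1. u n (-1) = 0 \<and> u n 0 = 0) \<and>
     (\<forall>t. u 0 (int t) = f t)"

text \<open>
  The values of the solution at times \<open>t \<ge> 0\<close>. The third equation is the time step from
  \<open>t = 0\<close>, with the value at time \<open>-1\<close> replaced by \<open>0\<close>.
\<close>

fun wave :: "(nat \<Rightarrow> real) \<Rightarrow> (nat \<Rightarrow> real) \<Rightarrow> nat \<Rightarrow> nat \<Rightarrow> real" where
  "wave b f 0 t = f t"
| "wave b f (Suc n) 0 = 0"
| "wave b f (Suc n) (Suc 0) =
     wave b f (Suc (Suc n)) 0 + wave b f n 0 - b (Suc n) * wave b f (Suc n) 0"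
| "wave b f (Suc n) (Suc (Suc t)) =
     wave b f (Suc (Suc n)) (Suc t) + wave b f n (Suc t)
       - b (Suc n) * wave b f (Suc n) (Suc t) - wave b f (Suc n) t"

lemma is_solution_wave: "is_solution b f (\<lambda>n t. if t < 0 then 0 else wave b f n (nat t))"
proof -
  let ?u = "\<lambda>n t. if t < 0 then 0 else wave b f n (nat t)"
  have "?u n (t + 1) + ?u n (t - 1) - ?u (n + 1) t - ?u (n - 1) t + b n * ?u n t = 0"
    if n: "n \<ge> 1" and t: "t \<ge> 0" for n and t :: int
  proof -
    obtain m where m: "n = Suc m" using n by (cases n) auto
    obtain s where s: "t = int s" using t nonneg_int_cases by blast
    show ?thesis
    proof (cases s)
      case 0
      then show ?thesis using m s by simp
    next
      case (Suc s')
      have "nat (int s + 1) = Suc (Suc s')" "nat (int s - 1) = s'" "nat (1 + int s') = Suc s'"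
        using Suc by auto
      then show ?thesis using m s Suc by simp
    qed
  qed
  moreover have "wave b f n 0 = 0" if "n \<ge> 1" for n
    using that by (cases n) auto
  ultimately show ?thesis unfolding is_solution_def by auto
qed

lemma is_solution_unique:
  assumes "is_solution b f u"
  shows "u n (int t) = wave b f n t"
proof -
  have step: "u (Suc n) (t + 1) =
      u (Suc (Suc n)) t + u n t - b (Suc n) * u (Suc n) t - u (Suc n) (t - 1)"
    if "t \<ge> 0" for n t
  proof -
    have "\<forall>n\<ge>1. \<forall>t\<ge>0. u n (t + 1) + u n (t - 1) - u (n + 1) t - u (n - 1) t + b n * u n t = 0"
      using assms unfolding is_solution_def by blast
    from this[rule_format, of "Suc n" t] that show ?thesis by simp
  qed
  have init: "u (Suc n) (-1) = 0" "u (Suc n) 0 = 0" and bd: "u 0 (int t) = f t" for n t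
    using assms unfolding is_solution_def by auto
  show ?thesis
  proof (induction t arbitrary: n rule: less_induct)
    case (less t)
    show ?case
    proof (cases n)
      case 0
      then show ?thesis using bd by simp
    next
      case (Suc m)
      consider "t = 0" | "t = Suc 0" | s where "t = Suc (Suc s)"
        by (metis not0_implies_Suc)
      then show ?thesis
      proof cases
        case 1
        then show ?thesis using Suc init by simp
      next
        case 2
        then show ?thesis
          using step[of 0 m] init[of m] less.IH[of 0 m] less.IH[of 0 "Suc m"]
            less.IH[of 0 "Suc (Suc m)"] Suc by simp
      next
        case 3
        then show ?thesis
          using step[of "int (Suc s)" m] less.IH[of s "Suc m"] less.IH[of "Suc s" m]
            less.IH[of "Suc s" "Suc m"] less.IH[of "Suc s" "Suc (Suc m)"] Suc
          by (simp add: add.commute)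
      qed
    qed
  qed
qed

lemma wave_cong:
  assumes "\<And>s. s < t \<Longrightarrow> f s = g s"
  shows "wave b f (Suc n) t = wave b g (Suc n) t"
  using assms
proof (induction t arbitrary: n rule: less_induct)
  case (less t)
  have IH: "wave b f m s = wave b g m s" if "s < t" for m s
    using less that by (cases m) auto
  consider "t = 0" | "t = Suc 0" | s where "t = Suc (Suc s)"
    by (metis not0_implies_Suc)
  then show ?case
    by cases (simp_all add: IH)
qed

abbreviation delta :: "nat \<Rightarrow> real" where
  "delta \<equiv> (\<lambda>t. if t = 0 then 1 else 0)"

lemma wave_convolution: "wave b f n t = (\<Sum>s\<le>t. wave b delta n s * f (t - s))"
proof (induction t arbitrary: n rule: less_induct)
  case (less t)
  show ?case
  proof (cases n)
    case 0
    have "(\<Sum>s\<le>t. wave b delta n s * f (t - s)) = (\<Sum>s\<le>t. if s = 0 then f t else 0)"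
      by (rule sum.cong) (auto simp: 0)
    then show ?thesis using 0 by simp
  next
    case (Suc m)
    consider "t = 0" | "t = Suc 0" | s where "t = Suc (Suc s)"
      by (metis not0_implies_Suc)
    then show ?thesis
    proof cases
      case 1
      then show ?thesis using Suc by simp
    next
      case 2
      then show ?thesis using Suc by (cases m) simp_all
    next
      case 3
      have "(\<Sum>k\<le>t. wave b delta n k * f (t - k)) =
          wave b delta (Suc m) (Suc 0) * f (Suc s) +
          (\<Sum>k\<le>s. wave b delta (Suc m) (Suc (Suc k)) * f (s - k))"
        unfolding 3 Suc
        by (simp add: sum.atMost_Suc_shift del: sum.atMost_Suc wave.simps(3,4))
      also have "\<dots> =
          (\<Sum>k\<le>Suc s. wave b delta (Suc (Suc m)) k * f (Suc s - k)) +
          (\<Sum>k\<le>Suc s. wave b delta m k * f (Suc s - k)) -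
          b (Suc m) * (\<Sum>k\<le>Suc s. wave b delta (Suc m) k * f (Suc s - k)) -
          (\<Sum>k\<le>s. wave b delta (Suc m) k * f (s - k))"
        by (simp add: sum.atMost_Suc_shift algebra_simps sum.distrib sum_subtractf
            sum_distrib_left del: sum.atMost_Suc)
      also have "\<dots> = wave b f n t"
        unfolding 3 Suc using less.IH 3 by simp
      finally show ?thesis by simp
    qed
  qed
qed

definition is_response_vector :: "(nat \<Rightarrow> real) \<Rightarrow> (nat \<Rightarrow> real) \<Rightarrow> bool" where
  "is_response_vector b r \<longleftrightarrow>
     (\<forall>f. \<forall>t\<ge>1. wave b f 1 t = (\<Sum>s=0..t-1. r s * f (t - 1 - s)))"

definition response_vector :: "(nat \<Rightarrow> real) \<Rightarrow> nat \<Rightarrow> real" where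
  "response_vector b = (THE r. is_response_vector b r)"

lemma is_response_vector_iff:
  "is_response_vector b r \<longleftrightarrow> r = (\<lambda>s. wave b delta 1 (s + 1))"
proof
  assume r: "is_response_vector b r"
  show "r = (\<lambda>s. wave b delta 1 (s + 1))"
  proof
    fix s
    have "wave b delta 1 (s + 1) = (\<Sum>k=0..s. r k * delta (s - k))"
      using r unfolding is_response_vector_def by simp
    also have "\<dots> = (\<Sum>k=0..s. if k = s then r s else 0)"
      by (rule sum.cong) auto
    finally show "r s = wave b delta 1 (s + 1)" by simp
  qed
next
  assume r: "r = (\<lambda>s. wave b delta 1 (s + 1))"
  show "is_response_vector b r"
    unfolding is_response_vector_def
  proof (intro allI impI)
    fix f :: "nat \<Rightarrow> real" and t :: nat
    assume "t \<ge> 1"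
    then obtain u where t: "t = Suc u" by (cases t) auto
    show "wave b f 1 t = (\<Sum>s=0..t-1. r s * f (t - 1 - s))"
      by (simp add: r t wave_convolution[of b f] sum.atMost_Suc_shift atLeast0AtMost
          del: sum.atMost_Suc wave.simps(3,4))
  qed
qed

lemma response_vector_eq_delta: "response_vector b s = wave b delta 1 (s + 1)"
  unfolding response_vector_def is_response_vector_iff by simp

text \<open>
  Both \<open>\<F>\<^sup>T\<close> and \<open>\<H>\<^sup>T\<close> are \<open>carrier_vec T\<close> over the reals with \<open>\<bullet>\<close>.
  Vector entries are numbered from \<open>0\<close>, so \<open>f\<^sub>t\<close> is \<open>f $ t\<close> for a control and
  \<open>h\<^sub>n\<close> is \<open>h $ (n - 1)\<close> for a state. Controls are extended by zero, which by
  \<open>wave_cong\<close> does not affect the state at time \<open>T\<close>.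
\<close>

definition control_of_vec :: "real vec \<Rightarrow> nat \<Rightarrow> real" where
  "control_of_vec f t = (if t < dim_vec f then f $ t else 0)"

definition control_operator :: "(nat \<Rightarrow> real) \<Rightarrow> nat \<Rightarrow> real vec \<Rightarrow> real vec" where
  "control_operator b T f = vec T (\<lambda>i. wave b (control_of_vec f) (i + 1) T)"

definition connecting_operator :: "(nat \<Rightarrow> real) \<Rightarrow> nat \<Rightarrow> real vec \<Rightarrow> real vec" where
  "connecting_operator b T f =
     (THE c. c \<in> carrier_vec T \<and>
        (\<forall>g\<in>carrier_vec T. c \<bullet> g = control_operator b T f \<bullet> control_operator b T g))"

lemma control_operator_linear:
  assumes "g \<in> carrier_vec T"
  shows "control_operator b T g =
    vec T (\<lambda>i. \<Sum>j<T. control_operator b T (unit_vec T j) $ i * g $ j)"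
proof (rule eq_vecI)
  fix i assume "i < dim_vec (vec T (\<lambda>i. \<Sum>j<T. control_operator b T (unit_vec T j) $ i * g $ j))"
  then have i: "i < T" by simp
  define D where "D = wave b delta (i + 1)"
  have D0: "D 0 = 0" unfolding D_def by simp
  have W: "control_operator b T f $ i = (\<Sum>j<T. D (T - j) * f $ j)"
    if f: "f \<in> carrier_vec T" for f
  proof -
    have "control_operator b T f $ i = (\<Sum>s\<le>T. D s * control_of_vec f (T - s))"
      unfolding control_operator_def D_def using i by (simp add: wave_convolution[of b "control_of_vec f"])
    also have "\<dots> = (\<Sum>j\<le>T. D (T - j) * control_of_vec f j)"
      by (rule sum.reindex_bij_witness[of _ "\<lambda>j. T - j" "\<lambda>j. T - j"]) auto
    also have "\<dots> = (\<Sum>j<T. D (T - j) * control_of_vec f j)"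
      by (simp add: lessThan_Suc_atMost[symmetric] D0)
    also have "\<dots> = (\<Sum>j<T. D (T - j) * f $ j)"
      using f by (intro sum.cong) (auto simp: control_of_vec_def)
    finally show ?thesis .
  qed
  have "control_operator b T (unit_vec T j) $ i = D (T - j)" if "j < T" for j
  proof -
    have "control_operator b T (unit_vec T j) $ i = (\<Sum>k<T. if k = j then D (T - j) else 0)"
      unfolding W[OF unit_vec_carrier] using that by (intro sum.cong) (auto simp: unit_vec_def)
    then show ?thesis using that by simp
  qed
  then show "control_operator b T g $ i =
      vec T (\<lambda>i. \<Sum>j<T. control_operator b T (unit_vec T j) $ i * g $ j) $ i"
    using i by (simp add: W[OF assms])
qed (simp add: control_operator_def)

lemma connecting_operator_ex1:
  "\<exists>!c. c \<in> carrier_vec T \<and>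
     (\<forall>g\<in>carrier_vec T. c \<bullet> g = control_operator b T f \<bullet> control_operator b T g)"
proof (rule ex_ex1I)
  let ?w = "control_operator b T f"
  let ?c = "vec T (\<lambda>j. ?w \<bullet> control_operator b T (unit_vec T j))"
  have d: "dim_vec (control_operator b T h) = T" for h
    by (simp add: control_operator_def)
  have "?c \<bullet> g = ?w \<bullet> control_operator b T g" if g: "g \<in> carrier_vec T" for g
  proof -
    have "?w \<bullet> control_operator b T g =
        (\<Sum>i<T. ?w $ i * (\<Sum>j<T. control_operator b T (unit_vec T j) $ i * g $ j))"
      by (subst control_operator_linear[OF g]) (simp add: scalar_prod_def atLeast0LessThan)
    also have "\<dots> = (\<Sum>i<T. \<Sum>j<T. ?w $ i * control_operator b T (unit_vec T j) $ i * g $ j)"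
      by (simp add: sum_distrib_left mult.assoc)
    also have "\<dots> = (\<Sum>j<T. \<Sum>i<T. ?w $ i * control_operator b T (unit_vec T j) $ i * g $ j)"
      by (rule sum.swap)
    also have "\<dots> = ?c \<bullet> g"
      using g by (simp add: scalar_prod_def atLeast0LessThan sum_distrib_right d)
    finally show ?thesis by simp
  qed
  then show "\<exists>c. c \<in> carrier_vec T \<and>
      (\<forall>g\<in>carrier_vec T. c \<bullet> g = ?w \<bullet> control_operator b T g)"
    by (intro exI[of _ ?c]) simp
next
  fix c c'
  assume c: "c \<in> carrier_vec T \<and>
      (\<forall>g\<in>carrier_vec T. c \<bullet> g = control_operator b T f \<bullet> control_operator b T g)"
    and c': "c' \<in> carrier_vec T \<and>
      (\<forall>g\<in>carrier_vec T. c' \<bullet> g = control_operator b T f \<bullet> control_operator b T g)"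
  show "c = c'"
  proof (rule eq_vecI)
    fix i assume "i < dim_vec c'"
    then have i: "i < T" using c' by auto
    have "c \<bullet> unit_vec T i = c' \<bullet> unit_vec T i" using c c' by simp
    then show "c $ i = c' $ i" using c c' i by simp
  qed (use c c' in auto)
qed

end

theory Submission
  imports Defs
begin

text \<open>
  Write \<open>D n t = wave b delta n t\<close> for the response to the unit impulse. The control
  that is \<open>1\<close> at time \<open>j\<close> and \<open>0\<close> otherwise produces at time \<open>T\<close> the state \<open>D n (T - j)\<close>,
  so the entries of the matrix of the connecting operator are the numbers
  \<open>G (T - i) (T - j)\<close> with \<open>G s t = (\<Sum>n\<ge>1. D n s * D n t)\<close>, the Gram matrix of the
  impulse states.

  The point is that \<open>G\<close> satisfies, in its two time arguments, the wave equation without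
  potential: inserting the equation for \<open>D\<close> in
  \<open>G s (t + 1) + G s (t - 1) - G (s + 1) t - G (s - 1) t\<close> cancels the terms with \<open>b\<close>, and what
  is left telescopes by the discrete Green formula (\<open>discrete_green\<close>). The boundary
  term at \<open>n = 0\<close> vanishes because the impulse is over after time \<open>0\<close>, the one at
  large \<open>n\<close> because waves travel at unit speed. The equation says that
  \<open>G (s + 1) (t + 1) - G s t\<close> depends only on \<open>s + t\<close>; moving all the time to the first
  argument, and using that \<open>D n 1\<close> is supported at \<open>n = 1\<close>, its value is
  \<open>D 1 (s + t + 1) = r (s + t)\<close> (\<open>impulse_gram_diagonal_step\<close>). Summing these increments
  down the diagonal, until one of the arguments is \<open>0\<close> and \<open>G\<close> vanishes, gives the
  formula (\<open>impulse_gram_eq_sum_response\<close>).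
\<close>

lemma wave_delta_finite_speed: "t < n \<Longrightarrow> wave b delta n t = 0"
proof (induction t arbitrary: n rule: less_induct)
  case (less t)
  then obtain m where n: "n = Suc m" by (cases n) auto
  consider "t = 0" | "t = Suc 0" | s where "t = Suc (Suc s)"
    by (metis not0_implies_Suc)
  then show ?case
  proof cases
    case 2
    then show ?thesis using less.prems n by (cases m) simp_all
  qed (use less n in simp_all)
qed

lemma wave_delta_one: "wave b delta (Suc n) (Suc 0) = (if n = 0 then 1 else 0)"
  by (cases n) simp_all

lemma discrete_green:
  fixes u v :: "nat \<Rightarrow> real"
  shows "(\<Sum>n<N. u (Suc n) * (v (Suc (Suc n)) + v n) - (u (Suc (Suc n)) + u n) * v (Suc n)) =
    (u N * v (Suc N) - u (Suc N) * v N) - (u 0 * v 1 - u 1 * v 0)"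
  by (induction N) (simp_all add: algebra_simps)

text \<open>
  The sum stops at \<open>N\<close> instead of running over all \<open>n\<close>, which makes no difference
  unless \<open>N\<close> is smaller than both times.
\<close>

definition impulse_gram :: "(nat \<Rightarrow> real) \<Rightarrow> nat \<Rightarrow> nat \<Rightarrow> nat \<Rightarrow> real" where
  "impulse_gram b N s t = (\<Sum>n<N. wave b delta (Suc n) s * wave b delta (Suc n) t)"

lemma impulse_gram_0 [simp]: "impulse_gram b N 0 t = 0" "impulse_gram b N s 0 = 0"
  by (simp_all add: impulse_gram_def)

lemma impulse_gram_extend:
  assumes "s \<le> N" "N \<le> M"
  shows "impulse_gram b N s t = impulse_gram b M s t"
  unfolding impulse_gram_def using assms
  by (intro sum.mono_neutral_left) (auto intro: wave_delta_finite_speed)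

text \<open>
  The potential multiplies \<open>D n s * D n t\<close> on both sides and cancels. Both times have to
  be positive in the middle: at time \<open>0\<close> the impulse itself would contribute to the
  boundary term of Green's formula.
\<close>

lemma impulse_gram_wave_equation:
  assumes "s < N" "t < N"
  shows "impulse_gram b N (Suc s) (Suc (Suc t)) + impulse_gram b N (Suc s) t =
    impulse_gram b N (Suc (Suc s)) (Suc t) + impulse_gram b N s (Suc t)"
proof -
  let ?u = "\<lambda>n. wave b delta n (Suc s)" and ?v = "\<lambda>n. wave b delta n (Suc t)"
  have "impulse_gram b N (Suc s) (Suc (Suc t)) + impulse_gram b N (Suc s) t
      - impulse_gram b N (Suc (Suc s)) (Suc t) - impulse_gram b N s (Suc t)
    = (\<Sum>n<N. ?u (Suc n) * (?v (Suc (Suc n)) + ?v n) - (?u (Suc (Suc n)) + ?u n) * ?v (Suc n))"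
    unfolding impulse_gram_def sum.distrib[symmetric] sum_subtractf[symmetric]
    by (intro sum.cong refl) (simp add: algebra_simps)
  also have "\<dots> = (?u N * ?v (Suc N) - ?u (Suc N) * ?v N) - (?u 0 * ?v 1 - ?u 1 * ?v 0)"
    by (rule discrete_green)
  also have "\<dots> = 0"
    using assms by (simp add: wave_delta_finite_speed del: wave.simps(3,4))
  finally show ?thesis by simp
qed

text \<open>
  By the wave equation the increment along a diagonal is the same at \<open>(s, t + 1)\<close> and at
  \<open>(s + 1, t)\<close>, so it can be computed at \<open>(s + t, 0)\<close>, where only the site \<open>n = 1\<close>
  contributes. The bound \<open>s + t + 1\<close> on \<open>N\<close> is the largest time reached when all of \<open>t\<close> has been moved to the
  first argument.
\<close>

lemma impulse_gram_diagonal_step: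
  assumes "s + t < N"
  shows "impulse_gram b N (Suc s) (Suc t) = impulse_gram b N s t + response_vector b (s + t)"
  using assms
proof (induction t arbitrary: s)
  case 0
  then obtain M where N: "N = Suc M" by (cases N) auto
  show ?case
    unfolding impulse_gram_def wave_delta_one response_vector_eq_delta N
      sum.lessThan_Suc_shift
    by (simp del: wave.simps(3,4))
next
  case (Suc t)
  then show ?case
    using Suc.IH[of "Suc s"] impulse_gram_wave_equation[of s N t b] by simp
qed

lemma impulse_gram_eq_sum_response:
  assumes "s + t \<le> N"
  shows "impulse_gram b N s t =
    (\<Sum>k<min s t. response_vector b (nat \<bar>int s - int t\<bar> + 2 * k))"
  using assms
proof (induction s arbitrary: t)
  case 0
  then show ?case by simp
next
  case (Suc s)
  show ?case
  proof (cases t)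
    case 0
    then show ?thesis by simp
  next
    case (Suc t')
    have "nat \<bar>int s - int t'\<bar> + 2 * min s t' = s + t'" by linarith
    then show ?thesis
      using Suc Suc.IH[of t'] Suc.prems impulse_gram_diagonal_step[of s t' N b] by simp
  qed
qed

lemma control_operator_unit_vec:
  assumes "n < T" "j < T"
  shows "control_operator b T (unit_vec T j) $ n = wave b delta (Suc n) (T - j)"
proof -
  have "control_operator b T (unit_vec T j) $ n =
      (\<Sum>s\<le>T. wave b delta (Suc n) s * control_of_vec (unit_vec T j) (T - s))"
    using assms by (simp add: control_operator_def wave_convolution[of b "control_of_vec _"])
  also have "\<dots> = (\<Sum>s\<le>T. if s = T - j then wave b delta (Suc n) s else 0)"
    using assms by (intro sum.cong) (auto simp: control_of_vec_def unit_vec_def)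
  finally show ?thesis by simp
qed

lemma control_operator_scalar_prod_unit_vecs:
  assumes "i < T" "j < T"
  shows "(\<Sum>n<T. control_operator b T (unit_vec T i) $ n * control_operator b T (unit_vec T j) $ n)
    = (\<Sum>k=0..T - max (i + 1) (j + 1).
         response_vector b (nat \<bar>int (i + 1) - int (j + 1)\<bar> + 2 * k))"
proof -
  have "(\<Sum>n<T. control_operator b T (unit_vec T i) $ n * control_operator b T (unit_vec T j) $ n)
      = impulse_gram b T (T - i) (T - j)"
    unfolding impulse_gram_def using assms
    by (intro sum.cong refl) (simp add: control_operator_unit_vec)
  also have "\<dots> = impulse_gram b (2 * T) (T - i) (T - j)"
    by (rule impulse_gram_extend) auto
  also have "\<dots> = (\<Sum>k<min (T - i) (T - j).
      response_vector b (nat \<bar>int (T - i) - int (T - j)\<bar> + 2 * k))"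
    by (rule impulse_gram_eq_sum_response) auto
  also have "{..<min (T - i) (T - j)} = {0..T - max (i + 1) (j + 1)}"
    using assms by auto
  also have "\<bar>int (T - i) - int (T - j)\<bar> = \<bar>int (i + 1) - int (j + 1)\<bar>"
    using assms by linarith
  finally show ?thesis .
qed

lemma connecting_operator_spec:
  shows connecting_operator_carrier: "connecting_operator b T f \<in> carrier_vec T"
    and connecting_operator_scalar_prod: "g \<in> carrier_vec T \<Longrightarrow>
      connecting_operator b T f \<bullet> g = control_operator b T f \<bullet> control_operator b T g"
  using theI'[OF connecting_operator_ex1[of T b f]]
  unfolding connecting_operator_def by blast+

lemma connecting_operator_index:
  assumes f: "f \<in> carrier_vec T" and i: "i < T"
  shows "connecting_operator b T f $ i = (\<Sum>j<T.
    (\<Sum>n<T. control_operator b T (unit_vec T i) $ n * control_operator b T (unit_vec T j) $ n)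
      * f $ j)"
proof -
  let ?W = "\<lambda>j. control_operator b T (unit_vec T j)"
  have dim: "dim_vec (?W i) = T" by (simp add: control_operator_def)
  have "connecting_operator b T f $ i = connecting_operator b T f \<bullet> unit_vec T i"
    using connecting_operator_carrier i by (simp add: scalar_prod_right_unit)
  also have "\<dots> = control_operator b T f \<bullet> ?W i"
    by (simp add: connecting_operator_scalar_prod)
  also have "\<dots> = (\<Sum>n<T. (\<Sum>j<T. ?W j $ n * f $ j) * ?W i $ n)"
    by (subst control_operator_linear[OF f]) (simp add: scalar_prod_def dim atLeast0LessThan)
  also have "\<dots> = (\<Sum>n<T. \<Sum>j<T. ?W i $ n * ?W j $ n * f $ j)"
    by (simp add: sum_distrib_left sum_distrib_right mult_ac)
  also have "\<dots> = (\<Sum>j<T. \<Sum>n<T. ?W i $ n * ?W j $ n * f $ j)"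
    by (rule sum.swap)
  finally show ?thesis by (simp add: sum_distrib_right)
qed

theorem theorem2:
  fixes b :: "nat \<Rightarrow> real" and T :: nat
  assumes "T \<ge> 1"
  shows "let r = response_vector b;
             C = (\<lambda>i j. \<Sum>k=0..T - max i j. r (nat \<bar>int i - int j\<bar> + 2 * k))
         in r 0 = 1 \<and>
            (\<forall>f\<in>carrier_vec T. connecting_operator b T f =
               mat T T (\<lambda>(i, j). C (i + 1) (j + 1)) *\<^sub>v f) \<and>
            (\<forall>f\<in>carrier_vec T. \<forall>g\<in>carrier_vec T. connecting_operator b T f \<bullet> g =
               (\<Sum>i=1..T. \<Sum>j=1..T. C i j * f $ (j - 1) * g $ (i - 1)))"
proof -
  define C where "C = (\<lambda>i j. \<Sum>k=0..T - max i j.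
    response_vector b (nat \<bar>int i - int j\<bar> + 2 * k))"
  have entry: "connecting_operator b T f $ i = (\<Sum>j<T. C (i + 1) (j + 1) * f $ j)"
    if "f \<in> carrier_vec T" "i < T" for f i
    unfolding connecting_operator_index[OF that] C_def
    using that by (intro sum.cong refl) (simp add: control_operator_scalar_prod_unit_vecs)
  have r0: "response_vector b 0 = 1"
    by (simp add: response_vector_eq_delta)
  have matrix: "connecting_operator b T f = mat T T (\<lambda>(i, j). C (i + 1) (j + 1)) *\<^sub>v f"
    if f: "f \<in> carrier_vec T" for f
    using f connecting_operator_carrier[of b T f]
    by (intro eq_vecI) (auto simp: entry scalar_prod_def atLeast0LessThan)
  have form: "connecting_operator b T f \<bullet> g =
      (\<Sum>i=1..T. \<Sum>j=1..T. C i j * f $ (j - 1) * g $ (i - 1))"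
    if f: "f \<in> carrier_vec T" and g: "g \<in> carrier_vec T" for f g
  proof -
    have "connecting_operator b T f \<bullet> g = (\<Sum>i<T. connecting_operator b T f $ i * g $ i)"
      using g by (simp add: scalar_prod_def atLeast0LessThan)
    also have "\<dots> = (\<Sum>i<T. \<Sum>j<T. C (i + 1) (j + 1) * f $ j * g $ i)"
      using f by (simp add: entry sum_distrib_right)
    finally show ?thesis by (simp add: sum.atLeast1_atMost_eq)
  qed
  show ?thesis
    using r0 matrix form unfolding C_def Let_def by blast
qed

end
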